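(* Let $E_1,E_2,E_k$ be event sets with $E_1\cap E_2\subseteq E_k$, let $E=E_1\cup E_2\cup E_k$, and let $E_u\subseteq E$. Let $L_i\subseteq E_i^*$, $i=1,2,k$, be prefix-closed languages, let $L=L_1\|L_2\|L_k$, and let $K\subseteq L$ be a prefix-closed language that is conditionally decomposable with respect to $(E_{1+k},E_{2+k},E_k)$. Assume that, for $i=1,2$, the natural projection $P^{i+k}_k$ is a $(P^{i+k}_i)^{-1}(L_i)$-observer and is OCC for $(P^{i+k}_i)^{-1}(L_i)$. Then $\sup\mathrm{cC}(K,L,(E_{1+k,u},E_{2+k,u},E_{k,u}))$ is controllable with respect to $L$ and $E_u$; that is, $$\sup\mathrm{cC}\big(K,L,(E_{1+k,u},E_{2+k,u},E_{k,u})\big)\subseteq\sup\mathrm{C}(K,L,E_u).$$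
   Context: Notation. Event sets are finite alphabets. $E_{i+k}=E_i\cup E_k$; $E_{k,u}=E_u\cap E_k$; $E_{i+k,u}=E_u\cap E_{i+k}$. For $A\subseteq B$, the natural projection $B^*\to A^*$ is the monoid morphism erasing the symbols of $B\setminus A$ and fixing those of $A$. $P_k:E^*\to E_k^*$, $P_{i+k}:E^*\to E_{i+k}^*$, $P^{i+k}_k:E_{i+k}^*\to E_k^*$, $P^{i+k}_i:E_{i+k}^*\to E_i^*$ are natural projections. For languages $M_j\subseteq A_j^*$ the synchronous product is $\|_j M_j=\bigcap_j Q_j^{-1}(M_j)\subseteq(\bigcup_j A_j)^*$, with $Q_j:(\bigcup_l A_l)^*\to A_j^*$ the natural projection. $\overline M$ is the set of all prefixes of words of $M$; $M$ is prefix-closed if $M=\overline M$. Controllability. For a prefix-closed language $N$ over an event set $A$ and $A_u\subseteq A$, a language $M\subseteq A^*$ is controllable with respect to $N$ and $A_u$ if $\overline M A_u\cap N\subseteq\overline M$. $\sup\mathrm{C}(M,N,A_u)$ denotes the supremal controllable sublanguage of $M$ with respect to $N$ and $A_u$, i.e. the union of all sublanguages of $M$ that are controllable with respect to $N$ and $A_u$. Conditional decomposability: $K=P_{1+k}(K)\|P_{2+k}(K)\|P_k(K)$. Conditional controllability. A prefix-closed language $M\subseteq L$ is conditionally controllable with respect to $L=L_1\|L_2\|L_k$ and $(E_{1+k,u},E_{2+k,u},E_{k,u})$ if (i) $P_k(M)E_{k,u}\cap L_k\subseteq P_k(M)$; (ii.a) $P_{1+k}(M)E_{1+k,u}\cap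 \big(L_1\|P_k(M)\|P_k^{2+k}(L_2\|P_k(M))\big)\subseteq P_{1+k}(M)$; (ii.b) $P_{2+k}(M)E_{2+k,u}\cap \big(L_2\|P_k(M)\|P_k^{1+k}(L_1\|P_k(M))\big)\subseteq P_{2+k}(M)$. $\sup\mathrm{cC}(K,L,(E_{1+k,u},E_{2+k,u},E_{k,u}))$ denotes the supremal conditionally controllable sublanguage of $K$, i.e. the union of all conditionally controllable (prefix-closed) sublanguages of $K$. Observer. A natural projection $P:A^*\to B^*$, $B\subseteq A$, is an $N$-observer for $N\subseteq A^*$ if for all $t\in P(N)$ and $s\in\overline N$ such that $P(s)$ is a prefix of $t$, there exists $u\in A^*$ with $su\in N$ and $P(su)=t$. OCC. A natural projection $P:A^*\to B^*$, $B\subseteq A$, is output control consistent (OCC) for $N\subseteq A^*$ if for every $s\in\overline N$ of the form $s=\sigma_1\sigma_2\cdots\sigma_\ell$ or $s=s'\sigma_0\sigma_1\cdots\sigma_\ell$, $\ell\ge1$, where $\sigma_0,\sigma_\ell\in B$ and $\sigma_i\in A\setminus B$ for $i=1,\dots,\ell-1$: if $\sigma_\ell\in E_u$, then $\sigma_i\in E_u$ for all $i=1,\dots,\ell-1$. *)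

theory Defs
  imports "HOL-Library.Sublist"
begin

text \<open>
  Events are elements of an arbitrary type, words are lists, and the free monoid over an event
  set \<open>A\<close> is \<open>lists A\<close>. The natural projection from \<open>A\<close> onto a subset \<open>B\<close> is the restriction to
  \<open>lists A\<close> of a function that depends on \<open>B\<close> only, so the domain alphabet \<open>A\<close> is not an argument
  of \<open>natproj\<close>; it does matter for inverse images and is an argument of \<open>natproj_inv\<close>.
\<close>

definition natproj :: "'a set \<Rightarrow> 'a list \<Rightarrow> 'a list" where
  "natproj B w = filter (\<lambda>a. a \<in> B) w"

definition natproj_inv :: "'a set \<Rightarrow> 'a set \<Rightarrow> 'a list set \<Rightarrow> 'a list set" where
  "natproj_inv A B N = {w \<in> lists A. natproj B w \<in> N}"

text \<open>
  A synchronous product depends on the alphabets of its components, which a language does not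
  determine. A family of components is therefore given as a set of pairs (alphabet, language);
  identifying equal components is harmless, as the product is an intersection.
\<close>

definition sync :: "('a set \<times> 'a list set) set \<Rightarrow> 'a list set" where
  "sync \<F> = {w \<in> lists (\<Union>(A, M) \<in> \<F>. A). \<forall>(A, M) \<in> \<F>. natproj A w \<in> M}"

definition prefix_closure :: "'a list set \<Rightarrow> 'a list set" where
  "prefix_closure M = {s. \<exists>w \<in> M. prefix s w}"

definition prefix_closed :: "'a list set \<Rightarrow> bool" where
  "prefix_closed M \<longleftrightarrow> M = prefix_closure M"

definition append_events :: "'a list set \<Rightarrow> 'a set \<Rightarrow> 'a list set" where
  "append_events M U = {s @ [a] | s a. s \<in> M \<and> a \<in> U}"

definition controllable :: "'a list set \<Rightarrow> 'a list set \<Rightarrow> 'a set \<Rightarrow> bool" where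
  "controllable M N U \<longleftrightarrow> append_events (prefix_closure M) U \<inter> N \<subseteq> prefix_closure M"

definition supC :: "'a list set \<Rightarrow> 'a list set \<Rightarrow> 'a set \<Rightarrow> 'a list set" where
  "supC M N U = \<Union>{M'. M' \<subseteq> M \<and> controllable M' N U}"

definition cond_decomposable ::
  "'a set \<Rightarrow> 'a set \<Rightarrow> 'a set \<Rightarrow> 'a list set \<Rightarrow> bool" where
  "cond_decomposable E1 E2 Ek K \<longleftrightarrow>
     K = sync {(E1 \<union> Ek, natproj (E1 \<union> Ek) ` K), (E2 \<union> Ek, natproj (E2 \<union> Ek) ` K),
               (Ek, natproj Ek ` K)}"

text \<open>
  \<open>U1k\<close>, \<open>U2k\<close>, \<open>Uk\<close> are the uncontrollable events of \<open>E1 \<union> Ek\<close>, \<open>E2 \<union> Ek\<close>, \<open>Ek\<close>. The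
  components \<open>L1\<close>, \<open>L2\<close>, \<open>Lk\<close> and their alphabets are arguments, since the conditions refer to
  them and not just to their synchronous product.
\<close>

definition cond_controllable ::
  "'a set \<Rightarrow> 'a set \<Rightarrow> 'a set \<Rightarrow> 'a list set \<Rightarrow> 'a list set \<Rightarrow> 'a list set \<Rightarrow>
   'a set \<Rightarrow> 'a set \<Rightarrow> 'a set \<Rightarrow> 'a list set \<Rightarrow> bool" where
  "cond_controllable E1 E2 Ek L1 L2 Lk U1k U2k Uk M \<longleftrightarrow>
     prefix_closed M \<and>
     M \<subseteq> sync {(E1, L1), (E2, L2), (Ek, Lk)} \<and>
     append_events (natproj Ek ` M) Uk \<inter> Lk \<subseteq> natproj Ek ` M \<and>
     append_events (natproj (E1 \<union> Ek) ` M) U1k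
       \<inter> sync {(E1, L1), (Ek, natproj Ek ` M),
               (Ek, natproj Ek ` sync {(E2, L2), (Ek, natproj Ek ` M)})}
       \<subseteq> natproj (E1 \<union> Ek) ` M \<and>
     append_events (natproj (E2 \<union> Ek) ` M) U2k
       \<inter> sync {(E2, L2), (Ek, natproj Ek ` M),
               (Ek, natproj Ek ` sync {(E1, L1), (Ek, natproj Ek ` M)})}
       \<subseteq> natproj (E2 \<union> Ek) ` M"

definition sup_cC ::
  "'a set \<Rightarrow> 'a set \<Rightarrow> 'a set \<Rightarrow> 'a list set \<Rightarrow> 'a list set \<Rightarrow> 'a list set \<Rightarrow>
   'a set \<Rightarrow> 'a set \<Rightarrow> 'a set \<Rightarrow> 'a list set \<Rightarrow> 'a list set" where
  "sup_cC E1 E2 Ek L1 L2 Lk U1k U2k Uk K =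
     \<Union>{M. M \<subseteq> K \<and> cond_controllable E1 E2 Ek L1 L2 Lk U1k U2k Uk M}"

definition observer :: "'a set \<Rightarrow> 'a set \<Rightarrow> 'a list set \<Rightarrow> bool" where
  "observer A B N \<longleftrightarrow>
     (\<forall>t \<in> natproj B ` N. \<forall>s \<in> prefix_closure N. prefix (natproj B s) t \<longrightarrow>
        (\<exists>u \<in> lists A. s @ u \<in> N \<and> natproj B (s @ u) = t))"

text \<open>
  Below, \<open>v\<close> is the (possibly empty) block of erased events between two consecutive events of
  \<open>B\<close>, or between the beginning of the word and its first event of \<open>B\<close>.
\<close>

definition OCC :: "'a set \<Rightarrow> 'a set \<Rightarrow> 'a set \<Rightarrow> 'a list set \<Rightarrow> bool" where
  "OCC A B Eu N \<longleftrightarrow>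
     (\<forall>s \<in> prefix_closure N. \<forall>v \<in> lists (A - B). \<forall>b \<in> B.
        (s = v @ [b] \<or> (\<exists>s'. \<exists>b0 \<in> B. s = s' @ [b0] @ v @ [b])) \<longrightarrow>
        b \<in> Eu \<longrightarrow> set v \<subseteq> Eu)"

end

theory Submission
  imports Defs
begin

text \<open>
  The conditionally decomposable hull of a conditionally controllable \<open>M \<subseteq> K\<close>, that is the
  synchronous product of its three projections, has the same three projections as \<open>M\<close>, and it
  still lies in \<open>K\<close> because \<open>K\<close> is its own hull. Conditional controllability only speaks about these
  projections, so the hull is again conditionally controllable. An uncontrollable extension
  \<open>s @ [a] \<in> L\<close> of a word \<open>s \<in> M\<close> has each of its projections in the corresponding projection of \<open>M\<close>,
  by the three conditions, and hence lies in the hull.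
\<close>

definition cd_hull :: "'a set \<Rightarrow> 'a set \<Rightarrow> 'a set \<Rightarrow> 'a list set \<Rightarrow> 'a list set" where
  "cd_hull E1 E2 Ek M =
     sync {(E1 \<union> Ek, natproj (E1 \<union> Ek) ` M), (E2 \<union> Ek, natproj (E2 \<union> Ek) ` M),
           (Ek, natproj Ek ` M)}"

lemma natproj_append [simp]: "natproj B (v @ w) = natproj B v @ natproj B w"
  by (simp add: natproj_def)

lemma natproj_singleton [simp]: "natproj B [a] = (if a \<in> B then [a] else [])"
  by (simp add: natproj_def)

lemma natproj_in_lists [simp]: "natproj B w \<in> lists B"
  by (auto simp: natproj_def)

lemma natproj_natproj: "natproj A (natproj B w) = natproj (A \<inter> B) w"
  by (auto simp: natproj_def intro: filter_cong)

lemma natproj_natproj_subset: "A \<subseteq> B \<Longrightarrow> natproj A (natproj B w) = natproj A w"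
  by (simp add: natproj_natproj Int_absorb2)

lemma prefix_natproj: "prefix v w \<Longrightarrow> prefix (natproj B v) (natproj B w)"
  by (simp add: natproj_def filter_mono_prefix)

lemma prefix_closedD: "prefix_closed M \<Longrightarrow> w \<in> M \<Longrightarrow> prefix v w \<Longrightarrow> v \<in> M"
  unfolding prefix_closed_def prefix_closure_def by blast

lemma prefix_closedI: "(\<And>v w. w \<in> M \<Longrightarrow> prefix v w \<Longrightarrow> v \<in> M) \<Longrightarrow> prefix_closed M"
  unfolding prefix_closed_def prefix_closure_def by blast

lemma prefix_closed_Union: "(\<And>M. M \<in> \<M> \<Longrightarrow> prefix_closed M) \<Longrightarrow> prefix_closed (\<Union>\<M>)"
  by (rule prefix_closedI) (blast dest: prefix_closedD)

text \<open>Lifts prefixes back through a projection, so that projections of prefix-closed languages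
  are again prefix-closed. Induction on \<open>w\<close> from the right works because a prefix of
  the projection of \<open>w @ [a]\<close> is either that whole projection or already a prefix of
  the projection of \<open>w\<close>.\<close>

lemma prefix_natprojE:
  assumes "prefix v (natproj B w)"
  obtains u where "prefix u w" and "v = natproj B u"
proof -
  from assms have "\<exists>u. prefix u w \<and> v = natproj B u"
  proof (induction w rule: rev_induct)
    case (snoc a w)
    then have "prefix v (natproj B w) \<or> v = natproj B (w @ [a])"
      by (auto split: if_splits)
    with snoc.IH show ?case
      by (blast intro: prefix_prefix)
  qed (simp add: natproj_def)
  with that show thesis by blast
qed

lemma prefix_closed_natproj_image: "prefix_closed M \<Longrightarrow> prefix_closed (natproj B ` M)"
  by (rule prefix_closedI) (blast elim: prefix_natprojE dest: prefix_closedD)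

lemma prefix_closed_sync:
  assumes "\<And>A M. (A, M) \<in> \<F> \<Longrightarrow> prefix_closed M"
  shows "prefix_closed (sync \<F>)"
proof (rule prefix_closedI)
  fix v w
  assume w: "w \<in> sync \<F>" and v: "prefix v w"
  have "v \<in> lists (\<Union>(A, M) \<in> \<F>. A)"
    using w v by (auto simp: sync_def prefix_def)
  moreover have "natproj A v \<in> M" if "(A, M) \<in> \<F>" for A M
    using that w assms[OF that] prefix_natproj[OF v, of A]
    by (auto simp: sync_def dest: prefix_closedD)
  ultimately show "v \<in> sync \<F>"
    by (auto simp: sync_def)
qed

lemma in_sync3:
  "w \<in> sync {(A, M), (B, N), (C, P)} \<longleftrightarrow>
     w \<in> lists (A \<union> B \<union> C) \<and> natproj A w \<in> M \<and> natproj B w \<in> N \<and> natproj C w \<in> P"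
  by (auto simp: sync_def)

lemma in_cd_hull:
  "w \<in> cd_hull E1 E2 Ek M \<longleftrightarrow>
     w \<in> lists (E1 \<union> E2 \<union> Ek) \<and> natproj (E1 \<union> Ek) w \<in> natproj (E1 \<union> Ek) ` M \<and>
     natproj (E2 \<union> Ek) w \<in> natproj (E2 \<union> Ek) ` M \<and> natproj Ek w \<in> natproj Ek ` M"
  by (auto simp: cd_hull_def in_sync3)

lemma cd_hull_mono: "M \<subseteq> N \<Longrightarrow> cd_hull E1 E2 Ek M \<subseteq> cd_hull E1 E2 Ek N"
  by (simp add: subset_iff in_cd_hull) (meson image_mono subsetD subsetI)

lemma subset_cd_hull: "M \<subseteq> lists (E1 \<union> E2 \<union> Ek) \<Longrightarrow> M \<subseteq> cd_hull E1 E2 Ek M"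
  by (simp add: subset_iff in_cd_hull)

lemma cond_decomposable_iff: "cond_decomposable E1 E2 Ek K \<longleftrightarrow> K = cd_hull E1 E2 Ek K"
  by (simp add: cond_decomposable_def cd_hull_def)

lemma prefix_closed_cd_hull: "prefix_closed M \<Longrightarrow> prefix_closed (cd_hull E1 E2 Ek M)"
  unfolding cd_hull_def by (rule prefix_closed_sync) (auto intro: prefix_closed_natproj_image)

text \<open>One inclusion is built into the hull; the other holds because \<open>M\<close> lies in
  its hull. These equations let every condition stated through projections pass between
  \<open>M\<close> and its hull unchanged.\<close>

lemma natproj_image_cd_hull:
  assumes "M \<subseteq> lists (E1 \<union> E2 \<union> Ek)"
  shows "natproj (E1 \<union> Ek) ` cd_hull E1 E2 Ek M = natproj (E1 \<union> Ek) ` M"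
    and "natproj (E2 \<union> Ek) ` cd_hull E1 E2 Ek M = natproj (E2 \<union> Ek) ` M"
    and "natproj Ek ` cd_hull E1 E2 Ek M = natproj Ek ` M"
  by (intro equalityI image_mono subset_cd_hull assms image_subsetI; simp add: in_cd_hull)+

lemma sync_subset_lists: "sync {(E1, L1), (E2, L2), (Ek, Lk)} \<subseteq> lists (E1 \<union> E2 \<union> Ek)"
  by (auto simp: in_sync3)

lemma cd_hull_subset_sync:
  assumes "M \<subseteq> sync {(E1, L1), (E2, L2), (Ek, Lk)}"
  shows "cd_hull E1 E2 Ek M \<subseteq> sync {(E1, L1), (E2, L2), (Ek, Lk)}"
proof
  fix w
  assume w: "w \<in> cd_hull E1 E2 Ek M"
  \<comment> \<open>The three witnesses may be different words of \<open>M\<close>. This does no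
    harm: each component of the plant constrains only one projection of \<open>w\<close>, and that
    projection is determined by a single witness.\<close>
  then obtain x1 x2 xk where x: "x1 \<in> M" "natproj (E1 \<union> Ek) w = natproj (E1 \<union> Ek) x1"
      "x2 \<in> M" "natproj (E2 \<union> Ek) w = natproj (E2 \<union> Ek) x2"
      "xk \<in> M" "natproj Ek w = natproj Ek xk"
    by (auto simp: in_cd_hull)
  have "natproj E1 w = natproj E1 x1" "natproj E2 w = natproj E2 x2"
    using x natproj_natproj_subset[of E1 "E1 \<union> Ek"] natproj_natproj_subset[of E2 "E2 \<union> Ek"]
    by (metis Un_upper1)+
  with w x assms show "w \<in> sync {(E1, L1), (E2, L2), (Ek, Lk)}"
    by (auto simp: in_sync3 in_cd_hull)
qed

lemma cond_controllable_cd_hull: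
  assumes "cond_controllable E1 E2 Ek L1 L2 Lk U1k U2k Uk M"
  shows "cond_controllable E1 E2 Ek L1 L2 Lk U1k U2k Uk (cd_hull E1 E2 Ek M)"
proof -
  have "M \<subseteq> sync {(E1, L1), (E2, L2), (Ek, Lk)}"
    using assms by (simp add: cond_controllable_def)
  with sync_subset_lists have "M \<subseteq> lists (E1 \<union> E2 \<union> Ek)"
    by (rule order_trans[rotated])
  note proj = natproj_image_cd_hull[OF this]
  show ?thesis
    \<comment> \<open>After rewriting with \<open>proj\<close>, conditions (i), (ii.a) and (ii.b)
      for the hull are literally those for \<open>M\<close>; only prefix-closedness and inclusion in
      the plant remain.\<close>
    using assms unfolding cond_controllable_def proj
    by (elim conjE) (intro conjI prefix_closed_cd_hull cd_hull_subset_sync; assumption)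
qed

text \<open>Common form of the three controllability conditions, with \<open>N\<close> as the
  respective plant. If \<open>a\<close> is erased by the projection, the word projects like
  \<open>s\<close>, so the plant matters only for \<open>a \<in> B\<close>.\<close>

lemma append_events_natproj:
  assumes s: "s \<in> M" and a: "a \<in> U"
    and closed: "append_events (natproj B ` M) (U \<inter> B) \<inter> N \<subseteq> natproj B ` M"
    and N: "a \<in> B \<Longrightarrow> natproj B (s @ [a]) \<in> N"
  shows "natproj B (s @ [a]) \<in> natproj B ` M"
proof (cases "a \<in> B")
  case True
  then have "natproj B (s @ [a]) \<in> append_events (natproj B ` M) (U \<inter> B)"
    using s a by (auto simp: append_events_def)
  with closed N True show ?thesis by blast
qed (use s in simp)

lemma natproj_in_local_plant:
  assumes "natproj A w \<in> L" and "natproj B w \<in> L'" and "natproj C w \<in> N"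
  shows "natproj (A \<union> C) w \<in> sync {(A, L), (C, N), (C, natproj C ` sync {(B, L'), (C, N)})}"
proof -
  \<comment> \<open>The nested component asks for a word of the other subsystem with the same
    projection to \<open>C\<close>; \<open>w\<close> itself supplies one.\<close>
  have "natproj (B \<union> C) w \<in> sync {(B, L'), (C, N)}"
    using assms by (simp add: sync_def natproj_natproj_subset)
  then have "natproj C w \<in> natproj C ` sync {(B, L'), (C, N)}"
    by (metis Un_upper2 imageI natproj_natproj_subset)
  with assms show ?thesis
    by (simp only: in_sync3 natproj_natproj_subset Un_upper1 Un_upper2)
       (simp add: Un_assoc)
qed

lemma cond_controllable_append_events:
  assumes cc: "cond_controllable E1 E2 Ek L1 L2 Lk
      (Eu \<inter> (E1 \<union> Ek)) (Eu \<inter> (E2 \<union> Ek)) (Eu \<inter> Ek) M"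
  shows "append_events M Eu \<inter> sync {(E1, L1), (E2, L2), (Ek, Lk)} \<subseteq> cd_hull E1 E2 Ek M"
proof
  fix w
  assume w: "w \<in> append_events M Eu \<inter> sync {(E1, L1), (E2, L2), (Ek, Lk)}"
  then obtain s a where sa: "w = s @ [a]" "s \<in> M" "a \<in> Eu"
    by (auto simp: append_events_def)
  have L: "w \<in> lists (E1 \<union> E2 \<union> Ek)" "natproj E1 w \<in> L1" "natproj E2 w \<in> L2" "natproj Ek w \<in> Lk"
    using w by (simp_all add: in_sync3)
  have closed:
      "append_events (natproj Ek ` M) (Eu \<inter> Ek) \<inter> Lk \<subseteq> natproj Ek ` M"
      "append_events (natproj (E1 \<union> Ek) ` M) (Eu \<inter> (E1 \<union> Ek))
         \<inter> sync {(E1, L1), (Ek, natproj Ek ` M),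
                 (Ek, natproj Ek ` sync {(E2, L2), (Ek, natproj Ek ` M)})}
         \<subseteq> natproj (E1 \<union> Ek) ` M"
      "append_events (natproj (E2 \<union> Ek) ` M) (Eu \<inter> (E2 \<union> Ek))
         \<inter> sync {(E2, L2), (Ek, natproj Ek ` M),
                 (Ek, natproj Ek ` sync {(E1, L1), (Ek, natproj Ek ` M)})}
         \<subseteq> natproj (E2 \<union> Ek) ` M"
    using cc unfolding cond_controllable_def by blast+
  \<comment> \<open>Condition (i) has to come first: the plants in (ii.a) and (ii.b) synchronize
    with the projection of \<open>M\<close> to \<open>Ek\<close>, not with
    \<open>Lk\<close>.\<close>
  have k: "natproj Ek w \<in> natproj Ek ` M"
    using append_events_natproj[OF sa(2,3) closed(1)] L(4) sa(1) by blast
  moreover have "natproj (E1 \<union> Ek) w \<in> natproj (E1 \<union> Ek) ` M"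
    using append_events_natproj[OF sa(2,3) closed(2)] natproj_in_local_plant[OF L(2,3) k] sa(1)
    by blast
  moreover have "natproj (E2 \<union> Ek) w \<in> natproj (E2 \<union> Ek) ` M"
    using append_events_natproj[OF sa(2,3) closed(3)] natproj_in_local_plant[OF L(3,2) k] sa(1)
    by blast
  ultimately show "w \<in> cd_hull E1 E2 Ek M"
    using L(1) by (simp add: in_cd_hull)
qed

lemma prefix_closed_sup_cC: "prefix_closed (sup_cC E1 E2 Ek L1 L2 Lk U1k U2k Uk K)"
  unfolding sup_cC_def by (rule prefix_closed_Union) (simp add: cond_controllable_def)

lemma controllable_sup_cC:
  assumes "cond_decomposable E1 E2 Ek K"
  shows "controllable
           (sup_cC E1 E2 Ek L1 L2 Lk (Eu \<inter> (E1 \<union> Ek)) (Eu \<inter> (E2 \<union> Ek)) (Eu \<inter> Ek) K)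
           (sync {(E1, L1), (E2, L2), (Ek, Lk)}) Eu"
    (is "controllable ?S ?L Eu")
proof -
  have "w \<in> ?S" if w: "w \<in> append_events ?S Eu" "w \<in> ?L" for w
  proof -
    obtain M where M: "M \<subseteq> K" "w \<in> append_events M Eu"
      and cc: "cond_controllable E1 E2 Ek L1 L2 Lk
        (Eu \<inter> (E1 \<union> Ek)) (Eu \<inter> (E2 \<union> Ek)) (Eu \<inter> Ek) M"
      using w(1) unfolding append_events_def sup_cC_def by blast
    have "w \<in> cd_hull E1 E2 Ek M"
      using cond_controllable_append_events[OF cc] M(2) w(2) by blast
    \<comment> \<open>Conditional decomposability of \<open>K\<close> enters here: by monotonicity
      the hull of \<open>M\<close> lies in the hull of \<open>K\<close>, which is \<open>K\<close>.
      So the hull is itself one of the languages united in \<open>?S\<close>.\<close>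
    moreover have "cd_hull E1 E2 Ek M \<subseteq> K"
      using cd_hull_mono[OF M(1)] assms by (metis cond_decomposable_iff)
    ultimately show ?thesis
      using cond_controllable_cd_hull[OF cc] unfolding sup_cC_def by blast
  qed
  \<comment> \<open>As a union of prefix-closed languages, \<open>?S\<close> equals its prefix
    closure, so the claim about one-event extensions is already controllability.\<close>
  then show ?thesis
    by (auto simp: controllable_def prefix_closed_sup_cC[unfolded prefix_closed_def, symmetric])
qed

theorem theorem24:
  fixes E1 E2 Ek E Eu :: "'a set"
    and L1 L2 Lk L K :: "'a list set"
  assumes "finite E1" and "finite E2" and "finite Ek"
    and "E1 \<inter> E2 \<subseteq> Ek"
    and "E = E1 \<union> E2 \<union> Ek"
    and "Eu \<subseteq> E"
    and "L1 \<subseteq> lists E1" and "prefix_closed L1"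
    and "L2 \<subseteq> lists E2" and "prefix_closed L2"
    and "Lk \<subseteq> lists Ek" and "prefix_closed Lk"
    and "L = sync {(E1, L1), (E2, L2), (Ek, Lk)}"
    and "K \<subseteq> L" and "prefix_closed K"
    and "cond_decomposable E1 E2 Ek K"
    and "observer (E1 \<union> Ek) Ek (natproj_inv (E1 \<union> Ek) E1 L1)"
    and "OCC (E1 \<union> Ek) Ek Eu (natproj_inv (E1 \<union> Ek) E1 L1)"
    and "observer (E2 \<union> Ek) Ek (natproj_inv (E2 \<union> Ek) E2 L2)"
    and "OCC (E2 \<union> Ek) Ek Eu (natproj_inv (E2 \<union> Ek) E2 L2)"
  shows "controllable
           (sup_cC E1 E2 Ek L1 L2 Lk (Eu \<inter> (E1 \<union> Ek)) (Eu \<inter> (E2 \<union> Ek)) (Eu \<inter> Ek) K) L Eu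
       \<and> sup_cC E1 E2 Ek L1 L2 Lk (Eu \<inter> (E1 \<union> Ek)) (Eu \<inter> (E2 \<union> Ek)) (Eu \<inter> Ek) K
           \<subseteq> supC K L Eu"
proof
  show ctrl: "controllable
      (sup_cC E1 E2 Ek L1 L2 Lk (Eu \<inter> (E1 \<union> Ek)) (Eu \<inter> (E2 \<union> Ek)) (Eu \<inter> Ek) K) L Eu"
    unfolding \<open>L = _\<close> by (rule controllable_sup_cC) fact
  have "sup_cC E1 E2 Ek L1 L2 Lk (Eu \<inter> (E1 \<union> Ek)) (Eu \<inter> (E2 \<union> Ek)) (Eu \<inter> Ek) K \<subseteq> K"
    by (auto simp: sup_cC_def)
  with ctrl show "sup_cC E1 E2 Ek L1 L2 Lk (Eu \<inter> (E1 \<union> Ek)) (Eu \<inter> (E2 \<union> Ek)) (Eu \<inter> Ek) K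
      \<subseteq> supC K L Eu"
    unfolding supC_def by blast
qed

end
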